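(* Let $(X,\|\cdot\|_n)$ and $(Y,|\cdot|_n)$ be Fréchet spaces and let $U\subset X$ and $V\subset Y$ be nonempty and open. If the multi-valued map $F:X\rightrightarrows Y$ with closed graph is weakly $\Pi$-surjective on $(U,V)$, then there is $\theta>0$ such that $$F(B_{\rho_X}(x;r))\supset B_{\rho_Y}(y;\theta r)\cap V,\quad \forall (x,y)\in\mathrm{Gr}\,F\cap(U\times V),\ \forall r:\ 0<r<m_U(x),$$ where $m_U(x):=\mathrm{dist}(x,X\setminus U)$. That is, $F$ is restrictedly $\gamma$-open at linear rate on $(U,V)$ for $\gamma(x)=m_U(x)$.
   Context: A Fréchet space $(X,\|\cdot\|_n)$ is a linear space $X$ with a fixed collection of seminorms $\|\cdot\|_n$, $n=0,1,2,\ldots$, which is separating ($\|x\|_n=0$ for all $n$ iff $x=0$) and such that $X$ is complete in the metric $$\rho_X(x,y):=\max_{n\ge 0}\frac{2^{-n}\|x-y\|_n}{1+\|x-y\|_n}.$$ Topological notions and distances in $X$ refer to $\rho_X$; similarly for $Y$ with $\rho_Y$ built from $|\cdot|_n$. The distance to the empty set is $+\infty$. Balls are closed: $B_\rho(x;r):=\{y:\ \rho(x,y)\le r\}$. $\mathbb{R}_+^\infty:=\{(s_i)_{i=0}^\infty:\ s_i\ge 0\}$; for $\mathbf{s}\in\mathbb{R}_+^\infty$, $\Pi_{\mathbf{s}}(X):=\{x\in X:\ \|x\|_n\le s_n,\ \forall n\ge 0\}$ and $\Pi_{\mathbf{s}}(Y):=\{y\in Y:\ |y|_n\le s_n,\ \forall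 n\ge 0\}$. For a multi-valued map $F$ (values are subsets of $Y$, possibly empty), $\mathrm{Gr}\,F:=\{(x,y):\ y\in F(x)\}$ and $F(A):=\bigcup_{a\in A}F(a)$; $\mathrm{cl}$ denotes closure. $F:X\rightrightarrows Y$ is weakly $\Pi$-surjective on $(U,V)$ if there is a constant $\kappa>0$ such that whenever $(x,y)\in(U\times V)\cap\mathrm{Gr}\,F$ and $\mathbf{s}\in\mathbb{R}_+^\infty$ are such that $x+\Pi_{\mathbf{s}}(X)\subset U$, it holds that $$\mathrm{cl}\,F(x+\Pi_{\mathbf{s}}(X))\supset\{y+\kappa\Pi_{\mathbf{s}}(Y)\}\cap V.$$ A multi-valued map $F:M_1\rightrightarrows M_2$ between metric spaces $(M_i,\rho_i)$ is restrictedly $\gamma$-open at linear rate on $(U,V)$ if there is $\theta>0$ such that $F(B_{\rho_1}(x;t))\supset B_{\rho_2}(y;\theta t)\cap V$ whenever $(x,y)\in\mathrm{Gr}\,F$, $x\in U$, $y\in V$ and $t<\gamma(x)$. *)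

theory Defs
  imports "HOL-Analysis.Analysis"
begin

definition seminorm :: "('a::real_vector \<Rightarrow> real) \<Rightarrow> bool" where
  "seminorm p \<longleftrightarrow> (\<forall>x y. p (x + y) \<le> p x + p y) \<and> (\<forall>c x. p (c *\<^sub>R x) = \<bar>c\<bar> * p x)"

text \<open>The supremum below is a maximum, see \<open>frechet_dist_attained\<close> and \<open>frechet_dist_upper\<close>.\<close>

definition frechet_dist :: "(nat \<Rightarrow> 'a::real_vector \<Rightarrow> real) \<Rightarrow> 'a \<Rightarrow> 'a \<Rightarrow> real" where
  "frechet_dist p x y = (SUP n. (1/2)^n * p n (x - y) / (1 + p n (x - y)))"

locale frechet_space =
  fixes p :: "nat \<Rightarrow> 'a::real_vector \<Rightarrow> real"
  assumes seminorm: "\<And>n. seminorm (p n)"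
    and separating: "\<And>x. (\<forall>n. p n x = 0) \<longleftrightarrow> x = 0"
    and complete: "Metric_space.mcomplete UNIV (frechet_dist p)"

abbreviation frechet_topology :: "(nat \<Rightarrow> 'a::real_vector \<Rightarrow> real) \<Rightarrow> 'a topology" where
  "frechet_topology p \<equiv> Metric_space.mtopology UNIV (frechet_dist p)"

abbreviation frechet_cball :: "(nat \<Rightarrow> 'a::real_vector \<Rightarrow> real) \<Rightarrow> 'a \<Rightarrow> real \<Rightarrow> 'a set" where
  "frechet_cball p \<equiv> Metric_space.mcball UNIV (frechet_dist p)"

text \<open>The infimum in \<^typ>\<open>ereal\<close> over the empty set is \<open>\<infinity>\<close>.\<close>

definition dist_set :: "('a \<Rightarrow> 'a \<Rightarrow> real) \<Rightarrow> 'a \<Rightarrow> 'a set \<Rightarrow> ereal" where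
  "dist_set d x A = (INF a\<in>A. ereal (d x a))"

definition m_dist :: "(nat \<Rightarrow> 'a::real_vector \<Rightarrow> real) \<Rightarrow> 'a set \<Rightarrow> 'a \<Rightarrow> ereal" where
  "m_dist p U x = dist_set (frechet_dist p) x (UNIV - U)"

definition Pi_box :: "(nat \<Rightarrow> 'a::real_vector \<Rightarrow> real) \<Rightarrow> (nat \<Rightarrow> real) \<Rightarrow> 'a set" where
  "Pi_box p s = {x. \<forall>n. p n x \<le> s n}"

text \<open>A multi-valued map is a set-valued function, with empty values allowed;
  the image of \<open>A\<close> is \<open>\<Union>a\<in>A. F a\<close>.\<close>

definition Gr :: "('a \<Rightarrow> 'b set) \<Rightarrow> ('a \<times> 'b) set" where
  "Gr F = {(x, y). y \<in> F x}"

definition weakly_Pi_surjective ::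
  "(nat \<Rightarrow> 'a::real_vector \<Rightarrow> real) \<Rightarrow> (nat \<Rightarrow> 'b::real_vector \<Rightarrow> real) \<Rightarrow>
   ('a \<Rightarrow> 'b set) \<Rightarrow> 'a set \<Rightarrow> 'b set \<Rightarrow> bool" where
  "weakly_Pi_surjective p q F U V \<longleftrightarrow>
    (\<exists>\<kappa>>0. \<forall>x y s.
       (x, y) \<in> (U \<times> V) \<inter> Gr F \<longrightarrow> (\<forall>n. 0 \<le> s n) \<longrightarrow> (\<lambda>u. x + u) ` Pi_box p s \<subseteq> U \<longrightarrow>
       (\<lambda>v. y + \<kappa> *\<^sub>R v) ` Pi_box q s \<inter> V
         \<subseteq> frechet_topology q closure_of (\<Union>a\<in>(\<lambda>u. x + u) ` Pi_box p s. F a))"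

definition restrictedly_open_at_linear_rate ::
  "'a set \<Rightarrow> ('a \<Rightarrow> 'a \<Rightarrow> real) \<Rightarrow> 'b set \<Rightarrow> ('b \<Rightarrow> 'b \<Rightarrow> real) \<Rightarrow> ('a \<Rightarrow> ereal) \<Rightarrow>
   ('a \<Rightarrow> 'b set) \<Rightarrow> 'a set \<Rightarrow> 'b set \<Rightarrow> bool" where
  "restrictedly_open_at_linear_rate M1 d1 M2 d2 \<gamma> F U V \<longleftrightarrow>
    (\<exists>\<theta>>0. \<forall>x y t.
       (x, y) \<in> Gr F \<longrightarrow> x \<in> U \<longrightarrow> y \<in> V \<longrightarrow> ereal t < \<gamma> x \<longrightarrow>
       Metric_space.mcball M2 d2 y (\<theta> * t) \<inter> V \<subseteq> (\<Union>a\<in>Metric_space.mcball M1 d1 x t. F a))"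

context frechet_space
begin

lemma p_zero: "p n 0 = 0"
proof -
  have "p n (0 *\<^sub>R 0) = \<bar>0\<bar> * p n 0"
    using seminorm[of n] unfolding seminorm_def by blast
  then show ?thesis by simp
qed

lemma p_minus: "p n (- x) = p n x"
proof -
  have "p n ((-1) *\<^sub>R x) = \<bar>-1\<bar> * p n x"
    using seminorm[of n] unfolding seminorm_def by blast
  then show ?thesis by simp
qed

lemma p_triangle: "p n (x + y) \<le> p n x + p n y"
  using seminorm[of n] unfolding seminorm_def by blast

lemma p_nonneg: "0 \<le> p n x"
  using p_triangle[of n x "- x"] by (simp add: p_zero p_minus)

lemma term_nonneg: "0 \<le> (1/2)^n * p n z / (1 + p n z)"
  by (simp add: p_nonneg)

lemma term_le: "(1/2)^n * p n z / (1 + p n z) \<le> (1/2)^n"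
proof -
  have "p n z / (1 + p n z) \<le> 1"
    using p_nonneg[of n z] by (simp add: divide_le_eq)
  then have "(1/2)^n * (p n z / (1 + p n z)) \<le> (1/2)^n * 1"
    by (intro mult_left_mono) auto
  then show ?thesis by simp
qed

lemma bdd_terms: "bdd_above (range (\<lambda>n. (1/2)^n * p n z / (1 + p n z)))"
proof (rule bdd_aboveI2)
  fix n show "(1/2)^n * p n z / (1 + p n z) \<le> 1"
    using term_le[of n z] power_le_one[of "1/2::real" n] by simp
qed

lemma frechet_dist_upper: "(1/2)^n * p n (x - y) / (1 + p n (x - y)) \<le> frechet_dist p x y"
  unfolding frechet_dist_def by (rule cSUP_upper[OF UNIV_I bdd_terms])

lemma frechet_dist_attained:
  "\<exists>n. frechet_dist p x y = (1/2)^n * p n (x - y) / (1 + p n (x - y))"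
proof -
  define a where "a n = (1/2)^n * p n (x - y) / (1 + p n (x - y))" for n
  have "\<exists>m. \<forall>n. a n \<le> a m"
  proof (cases "\<exists>m. a m > 0")
    case True
    then obtain m where m: "a m > 0" by blast
    obtain N where N: "(1/2)^N < a m"
      using real_arch_pow_inv[OF m, of "1/2"] by auto
    have big: "a n < a m" if "n \<ge> N" for n
    proof -
      have "a n \<le> (1/2)^n" unfolding a_def by (rule term_le)
      also have "\<dots> \<le> (1/2)^N" using that by (intro power_decreasing) auto
      finally show ?thesis using N by simp
    qed
    have "Max (a ` {..N + m}) \<in> a ` {..N + m}" by (rule Max_in) auto
    then obtain k where k: "Max (a ` {..N + m}) = a k" by (rule imageE)
    have le: "a n \<le> a k" if "n \<le> N + m" for n
      unfolding k[symmetric] using that by (intro Max_ge) auto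
    have "a n \<le> a k" for n
      using le[of n] le[of m] big[of n] by (cases "n \<le> N + m") auto
    then show ?thesis by blast
  next
    case False
    then have "a n \<le> a 0" for n
      using term_nonneg[of 0 "x - y"] unfolding a_def by (meson le_less_trans not_le)
    then show ?thesis by blast
  qed
  then obtain m where "\<forall>n. a n \<le> a m" by blast
  then have "(SUP n. a n) = a m" by (intro cSup_eq_maximum) auto
  then show ?thesis unfolding frechet_dist_def a_def by blast
qed

lemma Metric_space_frechet_dist: "Metric_space UNIV (frechet_dist p)"
proof
  fix x y z :: 'a
  show "0 \<le> frechet_dist p x y"
    using frechet_dist_upper[of 0 x y] term_nonneg[of 0 "x - y"] by linarith
  show "frechet_dist p x y = frechet_dist p y x"
  proof -
    have "p n (x - y) = p n (y - x)" for n
      using p_minus[of n "y - x"] by simp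
    then show ?thesis by (simp only: frechet_dist_def)
  qed
  show "frechet_dist p x y = 0 \<longleftrightarrow> x = y"
  proof
    assume 0: "frechet_dist p x y = 0"
    have "p n (x - y) = 0" for n
    proof -
      have "(1/2)^n * p n (x - y) / (1 + p n (x - y)) = 0"
        using frechet_dist_upper[of n x y] term_nonneg[of n "x - y"] 0 by linarith
      then show ?thesis using p_nonneg[of n "x - y"] by auto
    qed
    then show "x = y" using separating[of "x - y"] by simp
  next
    assume "x = y" then show "frechet_dist p x y = 0"
      by (simp add: frechet_dist_def p_zero)
  qed
  obtain n where n: "frechet_dist p x z = (1/2)^n * p n (x - z) / (1 + p n (x - z))"
    using frechet_dist_attained by blast
  define a b c where "a = p n (x - z)" and "b = p n (x - y)" and "c = p n (y - z)"
  have nn: "0 \<le> a" "0 \<le> b" "0 \<le> c" unfolding a_def b_def c_def by (rule p_nonneg)+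
  have "a \<le> b + c"
    using p_triangle[of n "x - y" "y - z"] unfolding a_def b_def c_def by simp
  have "a / (1 + a) = 1 - 1 / (1 + a)"
    using nn by (simp add: diff_divide_eq_iff)
  also have "\<dots> \<le> 1 - 1 / (1 + (b + c))"
    using nn \<open>a \<le> b + c\<close> by (intro diff_left_mono divide_left_mono) auto
  also have "\<dots> = (b + c) / (1 + (b + c))"
    using nn by (simp add: diff_divide_eq_iff)
  also have "\<dots> = b / (1 + (b + c)) + c / (1 + (b + c))" by (rule add_divide_distrib)
  also have "\<dots> \<le> b / (1 + b) + c / (1 + c)"
    using nn by (intro add_mono divide_left_mono) auto
  finally have "(1/2)^n * (a / (1 + a)) \<le> (1/2)^n * (b / (1 + b) + c / (1 + c))"
    by (intro mult_left_mono) auto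
  then show "frechet_dist p x z \<le> frechet_dist p x y + frechet_dist p y z"
    using n frechet_dist_upper[of n x y] frechet_dist_upper[of n y z]
    unfolding a_def b_def c_def by (simp add: distrib_left)
qed

end

end

theory Submission
  imports Defs
begin

text \<open>Weak \<open>\<Pi>\<close>-surjectivity applied with \<open>s\<^sub>n = |v - y|\<^sub>n / \<kappa>\<close> says that, with \<open>K = max 1 (1/\<kappa>)\<close>,
  a target \<open>v\<close> can be approximated arbitrarily well by values of \<open>F\<close> on the ball around \<open>x\<close> of
  radius \<open>K \<rho>(y, v)\<close>. Since the quality of the approximation is at our disposal, one can iterate
  this with geometrically decreasing radii \<open>r/2, r/4, \<dots>\<close>: the points stay in the ball of
  radius \<open>r\<close> around the first one, are Cauchy, and their limit has \<open>v\<close> as a value because the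
  graph is closed.\<close>

lemma approximate_openness_imp_openness:
  assumes "Metric_space UNIV d" and "Metric_space UNIV e"
    and complete: "Metric_space.mcomplete UNIV d"
    and closed: "closedin (prod_topology (Metric_space.mtopology UNIV d)
                  (Metric_space.mtopology UNIV e)) (Gr F)"
    and V: "openin (Metric_space.mtopology UNIV e) V" "v \<in> V"
    and K: "0 < K" and r: "0 < r"
    and step: "\<And>x y. (x, y) \<in> Gr F \<Longrightarrow> y \<in> V \<Longrightarrow> Metric_space.mcball UNIV d x (K * e y v) \<subseteq> U \<Longrightarrow>
      v \<in> Metric_space.mtopology UNIV e closure_of
             (\<Union>a\<in>Metric_space.mcball UNIV d x (K * e y v). F a)"
    and xy: "(x, y) \<in> Gr F" "y \<in> V"
    and U: "Metric_space.mcball UNIV d x r \<subseteq> U"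
    and close: "K * e y v \<le> r / 2"
  shows "v \<in> (\<Union>a\<in>Metric_space.mcball UNIV d x r. F a)"
proof -
  interpret D: Metric_space UNIV d by fact
  interpret E: Metric_space UNIV e by fact
  \<comment> \<open>Invariant of the iteration: the radii \<open>r/2, r/4, ...\<close> of the first
    \<open>n\<close> steps sum to \<open>r * (1 - (1/2)^n)\<close>, and the remaining error is small
    enough for the next radius \<open>K * e (snd z) v\<close> to be at most
    \<open>r * (1/2)^Suc n\<close>. At \<open>n = 0\<close> this is the hypothesis
    \<open>close\<close>.\<close>
  define P where "P n z \<longleftrightarrow> z \<in> Gr F \<and> snd z \<in> V \<and> d x (fst z) \<le> r * (1 - (1/2)^n) \<and>
    K * e (snd z) v \<le> r * (1/2)^Suc n" for n :: nat and z
  define Q where "Q n z z' \<longleftrightarrow> d (fst z) (fst z') \<le> r * (1/2)^Suc n"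
    for n :: nat and z z' :: "'a \<times> 'b"
  have ex: "\<exists>z'. P (Suc n) z' \<and> Q n z z'" if "P n z" for n z
  proof -
    obtain a b where z: "z = (a, b)" by (cases z)
    have ab: "(a, b) \<in> Gr F" "b \<in> V" "d x a \<le> r * (1 - (1/2)^n)" "K * e b v \<le> r * (1/2)^Suc n"
      using that by (auto simp: P_def z)
    \<comment> \<open>Used twice: it keeps the next ball inside the one of radius \<open>r\<close>,
      hence inside \<open>U\<close>, so that \<open>step\<close> applies; and it gives the distance
      part of the invariant for the new point.\<close>
    have near: "d x u \<le> r * (1 - (1/2)^Suc n)" if "d a u \<le> K * e b v" for u
      using that ab D.triangle[of x a u] by (simp add: algebra_simps)
    also have "r * (1 - (1/2)^Suc n) \<le> r" using r by (simp add: mult_le_cancel_left1)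
    finally have "D.mcball a (K * e b v) \<subseteq> U"
      using U by auto
    from step[OF ab(1,2) this]
    have cl: "v \<in> E.mtopology closure_of (\<Union>a\<in>D.mcball a (K * e b v). F a)" .
    obtain \<delta> where \<delta>: "\<delta> > 0" "E.mball v \<delta> \<subseteq> V"
      using V by (auto simp: E.openin_mtopology)
    \<comment> \<open>The bound \<delta> keeps the new value in \<open>V\<close>, where
      \<open>step\<close> can be applied again; the other bound forces its error below the level
      that the invariant demands at \<open>Suc n\<close>.\<close>
    define \<epsilon> where "\<epsilon> = min \<delta> (r * (1/2)^Suc (Suc n) / K)"
    have "\<epsilon> > 0" using \<delta> r K by (simp add: \<epsilon>_def)
    then obtain b' a' where b': "b' \<in> E.mball v \<epsilon>" "d a a' \<le> K * e b v" "b' \<in> F a'"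
      using cl unfolding E.metric_closure_of by fastforce
    have "e b' v < \<epsilon>" using b'(1) by (simp add: E.commute)
    then have "K * e b' v \<le> r * (1/2)^Suc (Suc n)" "b' \<in> V"
      using K \<delta> b' by (auto simp: \<epsilon>_def field_simps E.commute)
    then have "P (Suc n) (a', b')"
      using b' near[OF b'(2)] by (simp add: P_def Gr_def)
    moreover have "Q n z (a', b')" using b' ab by (simp add: Q_def z)
    ultimately show ?thesis by blast
  qed
  have "P 0 (x, y)" using xy close by (simp add: P_def)
  then obtain z where P: "\<And>n. P n (z n)" and Q: "\<And>n. Q n (z n) (z (Suc n))"
    using dependent_nat_choice[of P Q] ex by metis
  define a b where "a n = fst (z n)" and "b n = snd (z n)" for n
  \<comment> \<open>Geometric sum of the step lengths \<open>r * (1/2)^Suc k\<close> over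
    \<open>m \<le> k < n\<close>.\<close>
  have tele: "d (a m) (a n) \<le> r * ((1/2)^m - (1/2)^n)" if "m \<le> n" for m n
    using that
  proof (induction n rule: dec_induct)
    case (step n)
    have "d (a n) (a (Suc n)) \<le> r * (1/2)^Suc n" using Q[of n] by (simp add: Q_def a_def)
    then show ?case using step.IH D.triangle[of "a m" "a n" "a (Suc n)"]
      by (simp add: algebra_simps)
  qed simp
  have pow: "\<exists>N. \<forall>n\<ge>N. C * (1/2)^n < \<epsilon>" if "\<epsilon> > 0" for C \<epsilon> :: real
  proof -
    have "(\<lambda>n. C * (1/2)^n) \<longlonglongrightarrow> C * 0" by (intro tendsto_intros) auto
    then have "eventually (\<lambda>n. C * (1/2)^n < \<epsilon>) sequentially"
      using that by (simp add: order_tendsto_iff)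
    then show ?thesis by (simp add: eventually_sequentially)
  qed
  have "D.MCauchy a"
    unfolding D.MCauchy_def
  proof (intro conjI allI impI)
    fix \<epsilon> :: real assume "\<epsilon> > 0"
    then obtain N where N: "\<And>n. n \<ge> N \<Longrightarrow> r * (1/2)^n < \<epsilon>" using pow by blast
    have "d (a m) (a n) < \<epsilon>" if "N \<le> m" "m \<le> n" for m n
    proof -
      have "r * ((1/2)^m - (1/2)^n) \<le> r * (1/2)^m" using r by simp
      then show ?thesis using tele[OF that(2)] N[OF that(1)] by linarith
    qed
    then show "\<exists>N. \<forall>n n'. N \<le> n \<longrightarrow> N \<le> n' \<longrightarrow> d (a n) (a n') < \<epsilon>"
      by (metis D.commute nat_le_linear)
  qed simp
  then obtain l where l: "limitin D.mtopology a l sequentially"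
    using complete unfolding D.mcomplete_def by blast
  have "limitin E.mtopology b v sequentially"
    unfolding E.limit_metric_sequentially
  proof (intro conjI allI impI)
    fix \<epsilon> :: real assume "\<epsilon> > 0"
    then obtain N where N: "\<And>n. n \<ge> N \<Longrightarrow> r / K * (1/2)^n < \<epsilon>" using pow by blast
    have "e (b n) v \<le> r / K * (1/2)^n" for n
    proof -
      have "K * e (b n) v \<le> r * (1/2)^Suc n" using P[of n] by (simp add: P_def b_def)
      also have "\<dots> \<le> r * (1/2)^n" using r by simp
      finally show ?thesis using K by (simp add: field_simps)
    qed
    then show "\<exists>N. \<forall>n\<ge>N. b n \<in> UNIV \<and> e (b n) v < \<epsilon>"
      using N by (meson UNIV_I le_less_trans)
  qed simp
  with l have "limitin (prod_topology D.mtopology E.mtopology) z (l, v) sequentially"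
    by (simp add: limitin_pairwise a_def[abs_def] b_def[abs_def] o_def)
  then have "(l, v) \<in> Gr F"
    using closed P by (elim limitin_closedin) (auto simp: P_def)
  \<comment> \<open>All iterates lie in the closed ball of radius \<open>r\<close>, and a closed
    ball contains the limits of its sequences.\<close>
  moreover have "d x l \<le> r"
  proof -
    have "d x (a n) \<le> r" for n
    proof -
      have "r * (1 - (1/2)^n) \<le> r" using r by (simp add: mult_le_cancel_left1)
      then show ?thesis using P[of n] by (simp add: P_def a_def)
    qed
    then have "l \<in> D.mcball x r"
      by (intro limitin_closedin[OF l D.closedin_mcball]) auto
    then show ?thesis by simp
  qed
  ultimately show ?thesis by (auto simp: Gr_def)
qed

lemma mcball_subset_if_less_m_dist:
  assumes "frechet_space p" and "ereal r < m_dist p U x"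
  shows "frechet_cball p x r \<subseteq> U"
proof
  interpret frechet_space p by fact
  interpret Metric_space UNIV "frechet_dist p" by (rule Metric_space_frechet_dist)
  fix a assume a: "a \<in> frechet_cball p x r"
  show "a \<in> U"
  proof (rule ccontr)
    assume "a \<notin> U"
    then have "m_dist p U x \<le> ereal (frechet_dist p x a)"
      unfolding m_dist_def dist_set_def by (intro INF_lower) auto
    with assms a show False by (auto dest: less_le_trans)
  qed
qed

lemma (in frechet_space) p_scale: "p n (c *\<^sub>R x) = \<bar>c\<bar> * p n x"
  using seminorm[of n] unfolding seminorm_def by blast

text \<open>Turns a bound between seminorms into one between terms of the metrics. By monotonicity
  of \<open>u / (1 + u)\<close> the worst case is \<open>u = t / \<kappa>\<close>, with value
  \<open>t / (\<kappa> + t)\<close>; its denominator is at least \<open>\<kappa> * (1 + t)\<close>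
  if \<open>\<kappa> \<le> 1\<close> and at least \<open>1 + t\<close> otherwise.\<close>

lemma ratio_scaled_le:
  fixes t \<kappa> :: real
  assumes "0 \<le> t" "0 < \<kappa>" "0 \<le> u" "u \<le> t / \<kappa>"
  shows "u / (1 + u) \<le> max 1 (1/\<kappa>) * (t / (1 + t))"
proof -
  have "u / (1 + u) \<le> t / (\<kappa> + t)"
    using assms by (simp add: field_simps)
  also have "\<dots> \<le> max 1 (1/\<kappa>) * (t / (1 + t))"
  proof (cases "\<kappa> \<le> 1")
    case True
    have "\<kappa> * (1 + t) \<le> \<kappa> + t"
      using assms True by (simp add: distrib_left mult_left_le_one_le)
    then have "t / (\<kappa> + t) \<le> t / (\<kappa> * (1 + t))"
      using assms by (intro divide_left_mono) auto
    moreover have "max 1 (1/\<kappa>) = 1/\<kappa>" using assms True by (simp add: max_def)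
    ultimately show ?thesis by simp
  next
    case False
    then show ?thesis using assms by (auto simp: max_def intro!: divide_left_mono)
  qed
  finally show ?thesis .
qed

text \<open>The bridge from boxes to balls, and the source of the linear rate: the comparison of
  ratios is applied at the index where the maximum defining the distance in \<open>X\<close> is
  attained, with a factor independent of that index.\<close>

lemma translated_Pi_box_subset_cball:
  assumes "frechet_space p" "frechet_space q" "0 < \<kappa>"
  shows "(\<lambda>u. x + u) ` Pi_box p (\<lambda>n. q n (v - y) / \<kappa>)
           \<subseteq> frechet_cball p x (max 1 (1/\<kappa>) * frechet_dist q y v)"
proof
  interpret p: frechet_space p by fact
  interpret q: frechet_space q by fact
  interpret P: Metric_space UNIV "frechet_dist p" by (rule p.Metric_space_frechet_dist)
  interpret Q: Metric_space UNIV "frechet_dist q" by (rule q.Metric_space_frechet_dist)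
  fix a assume "a \<in> (\<lambda>u. x + u) ` Pi_box p (\<lambda>n. q n (v - y) / \<kappa>)"
  then have a: "p n (a - x) \<le> q n (v - y) / \<kappa>" for n
    by (auto simp: Pi_box_def)
  obtain n where n: "frechet_dist p a x = (1/2)^n * p n (a - x) / (1 + p n (a - x))"
    using p.frechet_dist_attained by blast
  also have "\<dots> \<le> (1/2)^n * (max 1 (1/\<kappa>) * (q n (v - y) / (1 + q n (v - y))))"
    unfolding times_divide_eq_right[symmetric]
    using assms a by (intro mult_left_mono ratio_scaled_le) (auto simp: p.p_nonneg q.p_nonneg)
  also have "\<dots> = max 1 (1/\<kappa>) * ((1/2)^n * q n (v - y) / (1 + q n (v - y)))" by simp
  also have "\<dots> \<le> max 1 (1/\<kappa>) * frechet_dist q v y"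
    by (intro mult_left_mono q.frechet_dist_upper) auto
  finally show "a \<in> frechet_cball p x (max 1 (1/\<kappa>) * frechet_dist q y v)"
    by (simp add: P.commute Q.commute)
qed

theorem theorem6:
  fixes p :: "nat \<Rightarrow> 'a::real_vector \<Rightarrow> real"
    and q :: "nat \<Rightarrow> 'b::real_vector \<Rightarrow> real"
    and F :: "'a \<Rightarrow> 'b set"
    and U :: "'a set" and V :: "'b set"
  assumes "frechet_space p" and "frechet_space q"
    and "U \<noteq> {}" and "openin (frechet_topology p) U"
    and "V \<noteq> {}" and "openin (frechet_topology q) V"
    and "closedin (prod_topology (frechet_topology p) (frechet_topology q)) (Gr F)"
    and "weakly_Pi_surjective p q F U V"
  shows "(\<exists>\<theta>>0. \<forall>(x, y) \<in> Gr F \<inter> (U \<times> V). \<forall>r. 0 < r \<and> ereal r < m_dist p U x \<longrightarrow>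
            frechet_cball q y (\<theta> * r) \<inter> V \<subseteq> (\<Union>a\<in>frechet_cball p x r. F a))
       \<and> restrictedly_open_at_linear_rate UNIV (frechet_dist p) UNIV (frechet_dist q)
            (m_dist p U) F U V"
proof -
  interpret p: frechet_space p by fact
  interpret q: frechet_space q by fact
  interpret P: Metric_space UNIV "frechet_dist p" by (rule p.Metric_space_frechet_dist)
  interpret Q: Metric_space UNIV "frechet_dist q" by (rule q.Metric_space_frechet_dist)
  obtain \<kappa> where \<kappa>: "\<kappa> > 0" and surj: "\<And>x y s. (x, y) \<in> (U \<times> V) \<inter> Gr F \<Longrightarrow> (\<forall>n. 0 \<le> s n) \<Longrightarrow>
      (\<lambda>u. x + u) ` Pi_box p s \<subseteq> U \<Longrightarrow>
      (\<lambda>v. y + \<kappa> *\<^sub>R v) ` Pi_box q s \<inter> V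
        \<subseteq> Q.mtopology closure_of (\<Union>a\<in>(\<lambda>u. x + u) ` Pi_box p s. F a)"
    using assms(8) unfolding weakly_Pi_surjective_def by blast
  define K where "K = max 1 (1/\<kappa>)"
  have K: "K > 0" by (simp add: K_def)
  have step: "v \<in> Q.mtopology closure_of (\<Union>a\<in>P.mcball x (K * frechet_dist q y v). F a)"
    if "(x, y) \<in> Gr F" "y \<in> V" "v \<in> V" and sub: "P.mcball x (K * frechet_dist q y v) \<subseteq> U" for x y v
  proof -
    \<comment> \<open>The smallest \<open>s\<close> for which \<open>y + \<kappa> \<Pi>_s\<close>
      contains \<open>v\<close>.\<close>
    let ?s = "\<lambda>n. q n (v - y) / \<kappa>"
    note box = translated_Pi_box_subset_cball
        [OF p.frechet_space_axioms q.frechet_space_axioms \<kappa>, of x v y, folded K_def]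
    \<comment> \<open>\<open>x\<close> is the centre of a ball of nonnegative radius contained in
      \<open>U\<close>.\<close>
    have "x \<in> U" using sub K by auto
    have "(1/\<kappa>) *\<^sub>R (v - y) \<in> Pi_box q ?s"
      using \<kappa> by (simp add: Pi_box_def q.p_scale)
    moreover have "v = y + \<kappa> *\<^sub>R ((1/\<kappa>) *\<^sub>R (v - y))" using \<kappa> by simp
    ultimately have "v \<in> (\<lambda>v. y + \<kappa> *\<^sub>R v) ` Pi_box q ?s" by blast
    moreover have "(\<lambda>v. y + \<kappa> *\<^sub>R v) ` Pi_box q ?s \<inter> V
        \<subseteq> Q.mtopology closure_of (\<Union>a\<in>(\<lambda>u. x + u) ` Pi_box p ?s. F a)"
      using that \<open>x \<in> U\<close> \<kappa> box by (intro surj) (auto simp: q.p_nonneg)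
    moreover have "\<dots> \<subseteq> Q.mtopology closure_of (\<Union>a\<in>P.mcball x (K * frechet_dist q y v). F a)"
      using box by (intro closure_of_mono UN_mono) auto
    ultimately show ?thesis using \<open>v \<in> V\<close> by blast
  qed
  \<comment> \<open>The rate \<open>1 / (2 * K)\<close> makes the first radius
    \<open>K * frechet_dist q y v\<close> at most \<open>r / 2\<close>, leaving the other half of
    \<open>r\<close> for all later steps.\<close>
  have main: "Q.mcball y (1 / (2 * K) * r) \<inter> V \<subseteq> (\<Union>a\<in>P.mcball x r. F a)"
    if "(x, y) \<in> Gr F" "y \<in> V" "0 < r" "ereal r < m_dist p U x" for x y r
  proof
    fix v assume v: "v \<in> Q.mcball y (1 / (2 * K) * r) \<inter> V"
    then have "K * frechet_dist q y v \<le> r / 2" using K by (simp add: field_simps)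
    moreover have "v \<in> V" using v by simp
    ultimately show "v \<in> (\<Union>a\<in>P.mcball x r. F a)"
      using approximate_openness_imp_openness[OF P.Metric_space_axioms Q.Metric_space_axioms
          p.complete assms(7,6) _ K \<open>0 < r\<close> step \<open>(x, y) \<in> Gr F\<close> \<open>y \<in> V\<close>
          mcball_subset_if_less_m_dist[OF assms(1) that(4)]]
      by blast
  qed
  have "1 / (2 * K) > 0" using K by simp
  moreover have "Q.mcball y (1 / (2 * K) * r) \<inter> V \<subseteq> (\<Union>a\<in>P.mcball x r. F a)"
    if "(x, y) \<in> Gr F" "y \<in> V" "ereal r < m_dist p U x" for x y r
  \<comment> \<open>Restricted openness also admits \<open>r \<le> 0\<close>: for negative
    \<open>r\<close> the ball around \<open>y\<close> is empty, and for \<open>r = 0\<close> it is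
    \<open>{y}\<close>, with \<open>y\<close> a value of \<open>F\<close> at \<open>x\<close>
    itself.\<close>
  proof (cases r "0 :: real" rule: linorder_cases)
    case less
    then have "1 / (2 * K) * r < 0" using K by (simp add: divide_neg_pos)
    then show ?thesis using Q.mcball_eq_empty by blast
  next
    case equal
    have "v = y" if "frechet_dist q y v \<le> 0" for v
      using that Q.nonneg[of y v] Q.zero[of y v] by auto
    then show ?thesis using that equal by (fastforce simp: Gr_def)
  next
    case greater
    then show ?thesis using main that by blast
  qed
  ultimately show ?thesis
    unfolding restrictedly_open_at_linear_rate_def
    by (intro conjI exI[of _ "1 / (2 * K)"]) blast+
qed

end
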